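(* $L(4,n) = \Omega\big(n^{\Theta(\ln n)}\big)$ as $n\to\infty$; in particular $L(4,n)$ is not bounded by any polynomial in $n$.
   Context: A coloring game is given by a finite set $V$ of $n$ players and a symmetric weight function $w$ with $w_{uv}=w_{vu}\in \mathbb{Z}\cup\{-\infty\}$ for distinct $u,v$. A state is a partition $P$ of $V$; $X(u)$ is the group of $u$ and $f_u(P)=\sum_{v\in X(u)\setminus\{u\}} w_{uv}$. A $k$-deviation from $P$ is a set $S$ of at most $k$ players and a (possibly empty) group $X$ of $P$ such that moving all players of $S$ into $X$ strictly increases the utility of every member of $S$. Starting from the all-singletons partition, $k$-deviations are applied successively. The game is uniform if all weights lie in $\{-\infty,1\}$. $L(k,n)$ is the maximum length of a sequence of successive $k$-deviations (from the all-singletons partition) over all uniform games with at most $n$ players. *)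

theory Defs
  imports
    "HOL-Library.Disjoint_Sets"
    "HOL-Library.Extended"
    "HOL-Library.Landau_Symbols"
    "HOL-Computational_Algebra.Polynomial"
begin

locale coloring_game =
  fixes V :: "'a set" and w :: "'a \<Rightarrow> 'a \<Rightarrow> int extended"
  assumes finite_players: "finite V"
    and weight_sym: "\<lbrakk>u \<in> V; v \<in> V; u \<noteq> v\<rbrakk> \<Longrightarrow> w u v = w v u"
    and weight_not_Pinf: "\<lbrakk>u \<in> V; v \<in> V; u \<noteq> v\<rbrakk> \<Longrightarrow> w u v \<noteq> Pinf"

locale uniform_coloring_game = coloring_game +
  assumes weight_uniform: "\<lbrakk>u \<in> V; v \<in> V; u \<noteq> v\<rbrakk> \<Longrightarrow> w u v \<in> {Minf, 1}"

definition group_of :: "'a set set \<Rightarrow> 'a \<Rightarrow> 'a set" where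
  "group_of P u = (THE X. X \<in> P \<and> u \<in> X)"

definition utility :: "('a \<Rightarrow> 'a \<Rightarrow> int extended) \<Rightarrow> 'a set set \<Rightarrow> 'a \<Rightarrow> int extended" where
  "utility w P u = (\<Sum>v \<in> group_of P u - {u}. w u v)"

text \<open>The members of \<open>S\<close> leave their groups and join \<open>X\<close>; groups that become empty disappear.
  For \<open>X = {}\<close> they form a new group.\<close>

definition move :: "'a set set \<Rightarrow> 'a set \<Rightarrow> 'a set \<Rightarrow> 'a set set" where
  "move P S X = insert (X \<union> S) ((\<lambda>Y. Y - S) ` (P - {X})) - {{}}"

text \<open>The set \<open>S\<close> must be nonempty, since an empty \<open>S\<close> would satisfy the improvement
  condition vacuously and could be repeated forever. The empty group is allowed as a target
  although it is not an element of the partition.\<close>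

definition is_deviation ::
    "'a set \<Rightarrow> ('a \<Rightarrow> 'a \<Rightarrow> int extended) \<Rightarrow> nat \<Rightarrow> 'a set set \<Rightarrow> 'a set \<Rightarrow> 'a set \<Rightarrow> bool" where
  "is_deviation V w k P S X \<longleftrightarrow>
     S \<subseteq> V \<and> S \<noteq> {} \<and> card S \<le> k \<and> (X \<in> P \<or> X = {}) \<and>
     (\<forall>u\<in>S. utility w P u < utility w (move P S X) u)"

definition deviation_step ::
    "'a set \<Rightarrow> ('a \<Rightarrow> 'a \<Rightarrow> int extended) \<Rightarrow> nat \<Rightarrow> 'a set set \<Rightarrow> 'a set set \<Rightarrow> bool" where
  "deviation_step V w k P Q \<longleftrightarrow> (\<exists>S X. is_deviation V w k P S X \<and> Q = move P S X)"

definition singletons :: "'a set \<Rightarrow> 'a set set" where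
  "singletons V = (\<lambda>u. {u}) ` V"

text \<open>Every finite game is isomorphic to one whose players are natural numbers. The lemma
  \<open>finite_deviation_lengths\<close> below shows that the maximum is taken over a finite set.\<close>

definition deviation_lengths :: "nat \<Rightarrow> nat \<Rightarrow> nat set" where
  "deviation_lengths k n =
     {m. \<exists>(V :: nat set) w P. uniform_coloring_game V w \<and> card V \<le> n \<and>
           (deviation_step V w k ^^ m) (singletons V) P}"

definition L :: "nat \<Rightarrow> nat \<Rightarrow> nat" where
  "L k n = Max (deviation_lengths k n)"

lemma group_of_eq:
  assumes "partition_on V P" "X \<in> P" "u \<in> X"
  shows "group_of P u = X"
  unfolding group_of_def
proof (rule the_equality)
  show "X \<in> P \<and> u \<in> X" using assms by simp
next
  fix Y assume "Y \<in> P \<and> u \<in> Y"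
  then show "Y = X"
    using partition_onD2[OF assms(1)] assms(2,3) by (auto simp: disjoint_def)
qed

lemma partition_on_move:
  assumes P: "partition_on V P" and "S \<subseteq> V" "X \<in> P \<or> X = {}"
  shows "partition_on V (move P S X)"
proof (rule partition_onI)
  have "\<Union>P = V" using partition_onD1[OF P] by simp
  then show "\<Union>(move P S X) = V" using assms(2,3) unfolding move_def by auto
next
  fix p q assume "p \<in> move P S X" "q \<in> move P S X" "p \<noteq> q"
  then show "disjnt p q"
    using partition_onD2[OF P] assms(3)
    unfolding move_def disjnt_def disjoint_def by (auto; blast)
next
  show "{} \<notin> move P S X" unfolding move_def by auto
qed

context uniform_coloring_game
begin

definition feasible :: "'a set set \<Rightarrow> bool" where
  "feasible P \<longleftrightarrow> partition_on V P \<and> (\<forall>Y\<in>P. \<forall>u\<in>Y. \<forall>v\<in>Y. u \<noteq> v \<longrightarrow> w u v = 1)"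

lemma sum_ones: "finite A \<Longrightarrow> (\<Sum>v\<in>A. (1 :: int extended)) = Fin (int (card A))"
  by (induction A rule: finite_induct) (auto simp: zero_extended_def one_extended_def)

lemma sum_Minf:
  fixes f :: "'b \<Rightarrow> int extended"
  assumes "finite A" "\<And>v. v \<in> A \<Longrightarrow> f v \<in> {Minf, 1}" "v \<in> A" "f v = Minf"
  shows "sum f A = Minf"
proof -
  have "sum f B \<noteq> Pinf" if "finite B" "B \<subseteq> A" for B
    using that
  proof (induction B rule: finite_induct)
    case empty
    then show ?case by (simp add: zero_extended_def)
  next
    case (insert x F)
    then have "f x \<in> {Minf, 1}" using assms(2) by simp
    with insert show ?case by (cases "sum f F") (auto simp: one_extended_def)
  qed
  then have "sum f (A - {v}) \<noteq> Pinf" using assms(1) by simp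
  moreover have "sum f A = f v + sum f (A - {v})"
    using assms(1,3) by (rule sum.remove)
  ultimately show ?thesis using assms(4) by (cases "sum f (A - {v})") auto
qed

lemma utility_feasible:
  assumes "feasible P" "Y \<in> P" "u \<in> Y"
  shows "utility w P u = Fin (int (card Y) - 1)"
proof -
  have p: "partition_on V P" using assms(1) by (simp add: feasible_def)
  have fin: "finite Y"
    using finite_players partition_onD1[OF p] assms(2) by (meson Union_upper finite_subset)
  have "utility w P u = (\<Sum>v\<in>Y - {u}. w u v)"
    by (simp add: utility_def group_of_eq[OF p assms(2,3)])
  also have "\<dots> = (\<Sum>v\<in>Y - {u}. 1)"
    using assms by (intro sum.cong) (auto simp: feasible_def)
  also have "\<dots> = Fin (int (card (Y - {u})))" using fin by (intro sum_ones) simp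
  also have "int (card (Y - {u})) = int (card Y) - 1"
    using fin assms(3) card_gt_0_iff[of Y] by (subst card_Diff_singleton) auto
  finally show ?thesis .
qed

lemma feasible_move:
  assumes f: "feasible P" and d: "is_deviation V w k P S X"
  shows "feasible (move P S X)"
proof -
  let ?Q = "move P S X"
  have p: "partition_on V P" using f by (simp add: feasible_def)
  have q: "partition_on V ?Q"
    using partition_on_move[OF p] d by (auto simp: is_deviation_def)
  have S: "S \<noteq> {}" "S \<subseteq> V" and X: "X \<in> P \<or> X = {}"
    using d by (auto simp: is_deviation_def)
  have inQ: "X \<union> S \<in> ?Q" using S by (auto simp: move_def)
  have sub: "X \<union> S \<subseteq> V" using inQ partition_onD1[OF q] by auto
  have one: "w u v = 1" if u: "u \<in> S" and v: "v \<in> X \<union> S" "u \<noteq> v" for u v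
  proof (rule ccontr)
    assume "w u v \<noteq> 1"
    then have "w u v = Minf" using weight_uniform[of u v] u v sub by auto
    have "(\<Sum>v\<in>X \<union> S - {u}. w u v) = Minf"
    proof (rule sum_Minf)
      show "finite (X \<union> S - {u})" using finite_subset[OF sub finite_players] by simp
      show "w u x \<in> {Minf, 1}" if "x \<in> X \<union> S - {u}" for x
        using that u sub by (intro weight_uniform) auto
      show "v \<in> X \<union> S - {u}" using v by auto
    qed fact
    then have "utility w ?Q u = Minf"
      using group_of_eq[OF q inQ] u by (simp add: utility_def)
    moreover have "utility w P u < utility w ?Q u" using d u by (simp add: is_deviation_def)
    ultimately show False by simp
  qed
  have "w u v = 1" if Y: "Y \<in> ?Q" and uv: "u \<in> Y" "v \<in> Y" "u \<noteq> v" for Y u v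
  proof (cases "Y = X \<union> S")
    case True
    consider "u \<in> S" | "v \<in> S" | "u \<in> X" "v \<in> X" using uv True by auto
    then show ?thesis
    proof cases
      case 1
      then show ?thesis using one uv True by auto
    next
      case 2
      then have "w v u = 1" using one uv True by auto
      then show ?thesis using weight_sym[of u v] uv True sub by auto
    next
      case 3
      then show ?thesis using f X uv by (auto simp: feasible_def)
    qed
  next
    case False
    then obtain Z where "Z \<in> P" "Y \<subseteq> Z" using Y by (auto simp: move_def)
    then show ?thesis using f uv by (auto simp: feasible_def)
  qed
  then show ?thesis using q by (auto simp: feasible_def)
qed

definition potential :: "'a set set \<Rightarrow> nat" where
  "potential P = (\<Sum>Y\<in>P. Suc (card V) ^ card Y)"

lemma card_partition_le:
  assumes "partition_on V P"
  shows "card P \<le> card V"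
proof -
  have "finite P" using finite_elements[OF finite_players assms] .
  have "card P = (\<Sum>Y\<in>P. 1)" by simp
  also have "\<dots> \<le> (\<Sum>Y\<in>P. card Y)"
  proof (rule sum_mono)
    fix Y assume "Y \<in> P"
    then have "Y \<noteq> {}" "finite Y"
      using partition_onD3[OF assms] partition_onD1[OF assms] finite_players
      by (auto intro: finite_subset)
    then show "1 \<le> card Y" by (simp add: Suc_le_eq card_gt_0_iff)
  qed
  also have "\<dots> = card V"
    using product_partition[OF assms] finite_players partition_onD1[OF assms]
    by (metis Union_upper finite_subset)
  finally show ?thesis .
qed

lemma potential_le:
  assumes "partition_on V P"
  shows "potential P \<le> card V * Suc (card V) ^ card V"
proof -
  have "potential P \<le> (\<Sum>Y\<in>P. Suc (card V) ^ card V)"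
    unfolding potential_def
  proof (rule sum_mono)
    fix Y assume "Y \<in> P"
    then have "card Y \<le> card V"
      using partition_onD1[OF assms] finite_players by (intro card_mono) auto
    then show "Suc (card V) ^ card Y \<le> Suc (card V) ^ card V"
      by (intro power_increasing) auto
  qed
  also have "\<dots> \<le> card V * Suc (card V) ^ card V"
    using card_partition_le[OF assms] by simp
  finally show ?thesis .
qed

lemma potential_move:
  assumes f: "feasible P" and d: "is_deviation V w k P S X"
  shows "potential P < potential (move P S X)"
proof -
  let ?Q = "move P S X" and ?N = "Suc (card V)" and ?m = "card (X \<union> S)"
  have p: "partition_on V P" using f by (simp add: feasible_def)
  have fQ: "feasible ?Q" using feasible_move[OF f d] .
  then have q: "partition_on V ?Q" by (simp add: feasible_def)
  have S: "S \<noteq> {}" "S \<subseteq> V" and X: "X \<in> P \<or> X = {}"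
    using d by (auto simp: is_deviation_def)
  have inQ: "X \<union> S \<in> ?Q" using S by (auto simp: move_def)
  have fin: "finite (X \<union> S)"
    using inQ partition_onD1[OF q] finite_players by (meson Union_upper finite_subset)
  have finP: "finite P" and finQ: "finite ?Q"
    using finite_elements[OF finite_players] p q by auto
  define A where "A = {Y \<in> P. Y \<inter> S = {} \<and> Y \<noteq> X}"
  have less: "card Y < ?m" if Y: "Y \<in> P" "Y \<inter> S \<noteq> {}" for Y
  proof -
    obtain u where u: "u \<in> Y" "u \<in> S" using Y by auto
    have "utility w P u < utility w ?Q u" using d u by (simp add: is_deviation_def)
    then show ?thesis
      using utility_feasible[OF f Y(1) u(1)] utility_feasible[OF fQ inQ, of u] u by simp
  qed
  have lessB: "card Y < ?m" if Y: "Y \<in> P - A" for Y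
  proof (cases "Y \<inter> S = {}")
    case True
    then have "Y = X" using Y by (auto simp: A_def)
    then have "Y \<subset> X \<union> S" using True S by auto
    then show ?thesis using fin by (simp add: psubset_card_mono)
  next
    case False
    then show ?thesis using less Y by auto
  qed
  have m: "?m > 0" using fin S by (simp add: card_gt_0_iff)
  have "(\<Sum>Y\<in>P - A. ?N ^ card Y) \<le> (\<Sum>Y\<in>P - A. ?N ^ (?m - 1))"
  proof (rule sum_mono)
    fix Y assume "Y \<in> P - A"
    from lessB[OF this] show "?N ^ card Y \<le> ?N ^ (?m - 1)"
      by (intro power_increasing) auto
  qed
  also have "\<dots> = card (P - A) * ?N ^ (?m - 1)" by simp
  also have "\<dots> \<le> card V * ?N ^ (?m - 1)"
    using card_partition_le[OF p] card_mono[OF finP, of "P - A"]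
    by (intro mult_right_mono) auto
  also have "\<dots> < ?N * ?N ^ (?m - 1)" by simp
  also have "\<dots> = ?N ^ ?m" using m by (cases ?m) simp_all
  finally have B: "(\<Sum>Y\<in>P - A. ?N ^ card Y) < ?N ^ ?m" .
  have AP: "A \<subseteq> P" by (auto simp: A_def)
  have AQ: "A \<subseteq> ?Q"
  proof
    fix Y assume Y: "Y \<in> A"
    then have "Y = Y - S" "Y \<noteq> {}" using partition_onD3[OF p] by (auto simp: A_def)
    then show "Y \<in> ?Q" using Y by (auto simp: A_def move_def)
  qed
  have nA: "X \<union> S \<notin> A" using S by (auto simp: A_def)
  have finA: "finite A" using finP AP finite_subset by auto
  have "potential P = (\<Sum>Y\<in>P - A. ?N ^ card Y) + (\<Sum>Y\<in>A. ?N ^ card Y)"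
    unfolding potential_def by (rule sum.subset_diff[OF AP finP])
  also have "\<dots> < ?N ^ ?m + (\<Sum>Y\<in>A. ?N ^ card Y)" using B by simp
  also have "\<dots> = (\<Sum>Y\<in>insert (X \<union> S) A. ?N ^ card Y)" using finA nA by simp
  also have "\<dots> \<le> potential ?Q"
    unfolding potential_def using finQ AQ inQ by (intro sum_mono2) auto
  finally show ?thesis .
qed

lemma feasible_singletons: "feasible (singletons V)"
  by (auto simp: feasible_def singletons_def partition_on_singletons)

lemma deviation_steps_le_potential:
  "(deviation_step V w k ^^ m) (singletons V) P \<Longrightarrow> feasible P \<and> m \<le> potential P"
proof (induction m arbitrary: P)
  case 0
  then show ?case using feasible_singletons by auto
next
  case (Suc m)
  then obtain R where "(deviation_step V w k ^^ m) (singletons V) R" "deviation_step V w k R P"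
    by auto
  with Suc.IH[of R] show ?case
    using feasible_move[of R k] potential_move[of R k]
    unfolding deviation_step_def by (metis Suc_leI order_le_less_trans)
qed

end

lemma finite_deviation_lengths: "finite (deviation_lengths k n)"
proof (rule finite_subset)
  show "deviation_lengths k n \<subseteq> {..n * Suc n ^ n}"
  proof
    fix m assume "m \<in> deviation_lengths k n"
    then obtain V :: "nat set" and w P where g: "uniform_coloring_game V w" and V: "card V \<le> n"
      and s: "(deviation_step V w k ^^ m) (singletons V) P"
      by (auto simp: deviation_lengths_def)
    interpret uniform_coloring_game V w by (rule g)
    have P: "feasible P" "m \<le> potential P" using deviation_steps_le_potential[OF s] by auto
    have "m \<le> card V * Suc (card V) ^ card V"
      using P potential_le[of P] unfolding feasible_def by linarith
    also have "\<dots> \<le> n * Suc n ^ n"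
    proof (rule mult_le_mono[OF V])
      have "Suc (card V) ^ card V \<le> Suc n ^ card V" using V by (intro power_mono) auto
      also have "\<dots> \<le> Suc n ^ n" using V by (intro power_increasing) auto
      finally show "Suc (card V) ^ card V \<le> Suc n ^ n" .
    qed
    finally show "m \<in> {..n * Suc n ^ n}" by simp
  qed
qed simp

lemma deviation_lengths_nonempty: "deviation_lengths k n \<noteq> {}"
proof -
  have "uniform_coloring_game ({} :: nat set) (\<lambda>_ _. 1)" by unfold_locales auto
  then have "0 \<in> deviation_lengths k n" unfolding deviation_lengths_def by fastforce
  then show ?thesis by auto
qed

end

theory Submission
  imports Defs "HOL-Real_Asymp.Real_Asymp"
begin

text \<open>When all weights are \<open>1\<close>, only the multiset of group sizes matters. Moving one player from
  each of four groups of size \<open>q + 3\<close> into a group of size \<open>q\<close> is a 4-deviation; it undoes two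
  transfers \<open>{i, i} \<rightarrow> {i - 1, i + 1}\<close> at \<open>i = q + 2\<close> and one at \<open>i = q + 1\<close>, and performs a single
  one at \<open>i = q + 3\<close>. So the transfer at \<open>p\<close>, which is one deviation by itself, can also be carried
  out by first making the transfer at \<open>p - 2\<close> and twice the one at \<open>p - 1\<close>, each in the same
  roundabout way. This takes at least \<open>2 ^ (p - 3)\<close> steps, and a stock of five groups of each size
  up to \<open>p\<close> suffices, hence \<open>O(p\<^sup>2)\<close> players. Thus \<open>L 4 n\<close> is even exponential in \<open>sqrt n\<close>.\<close>

section \<open>Group sizes as an abstraction of the game\<close>

definition group_sizes :: "'a set set \<Rightarrow> nat multiset" where
  "group_sizes P = image_mset card (mset_set P)"

text \<open>\<open>q\<close> is the size of the target group, \<open>N\<close> lists the sizes of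
  the groups that lose one player each, and \<open>R\<close> those of the bystanders. A mover from a
  group of size \<open>y\<close> gains iff \<open>y < q + size N\<close>; the filter drops groups
  that become empty.\<close>

definition size_step :: "nat \<Rightarrow> nat multiset \<Rightarrow> nat multiset \<Rightarrow> bool" where
  "size_step k M M' \<longleftrightarrow>
     (\<exists>q N R. M = add_mset q (N + R) \<and> N \<noteq> {#} \<and> size N \<le> k \<and> (\<forall>y\<in>#N. y < q + size N) \<and>
        M' = add_mset (q + size N) (filter_mset ((<) 0) (image_mset (\<lambda>y. y - 1) N) + R))"

lemma size_stepI:
  assumes "M = add_mset q (N + R)" "N \<noteq> {#}" "size N \<le> k" "\<forall>y\<in>#N. y < q + size N"
    "M' = add_mset (q + size N) (filter_mset ((<) 0) (image_mset (\<lambda>y. y - 1) N) + R)"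
  shows "size_step k M M'"
  unfolding size_step_def using assms by blast

section \<open>Realizing size steps in the game with all weights 1\<close>

lemma uniform_coloring_game_one:
  "finite V \<Longrightarrow> uniform_coloring_game V (\<lambda>_ _. 1)"
  by unfold_locales (auto simp: one_extended_def)

lemma utility_one:
  assumes "finite V" "partition_on V P" "Y \<in> P" "u \<in> Y"
  shows "utility (\<lambda>_ _. 1) P u = Fin (int (card Y) - 1)"
proof -
  interpret uniform_coloring_game V "\<lambda>_ _. 1"
    using uniform_coloring_game_one[OF assms(1)] .
  show ?thesis
    using assms by (intro utility_feasible) (auto simp: feasible_def)
qed

text \<open>Multiplicities in \<open>mset_set A\<close> are at most one, so both summands come from
  sets, and these are disjoint. This turns a splitting of sizes into a splitting of groups.\<close>

lemma mset_set_eq_plusD: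
  assumes "finite A" "mset_set A = B + C"
  obtains F G where "B = mset_set F" "C = mset_set G" "F \<union> G = A" "F \<inter> G = {}" "finite F" "finite G"
proof
  have c: "count B x + count C x = (if x \<in> A then 1 else 0)" for x
    using assms by (metis count_mset_set(1) count_mset_set(3) count_union)
  show "B = mset_set (set_mset B)" "C = mset_set (set_mset C)"
    by (rule multiset_eqI, use c count_greater_zero_iff in \<open>simp add: count_mset_set'\<close>,
        metis One_nat_def add_is_0 add_is_1 count_eq_zero_iff zero_neq_one)+
  show "set_mset B \<union> set_mset C = A"
    using assms by (metis finite_set_mset_mset_set set_mset_union)
  show "set_mset B \<inter> set_mset C = {}"
    using c by (force simp: set_eq_iff simp flip: count_greater_zero_iff split: if_splits)
qed auto

text \<open>One representative of each group behind \<open>N\<close> moves into the group behind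
  \<open>q\<close>. The resulting groups are shown to be pairwise distinct, so that no size is lost
  when passing from sets to multisets.\<close>

lemma size_step_realized:
  assumes fin: "finite V" and p: "partition_on V P" and "size_step k (group_sizes P) M"
  shows "\<exists>Q. deviation_step V (\<lambda>_ _. 1) k P Q \<and> partition_on V Q \<and> group_sizes Q = M"
proof -
  obtain q N R where s: "group_sizes P = add_mset q (N + R)" "N \<noteq> {#}" "size N \<le> k"
      "\<forall>y\<in>#N. y < q + size N"
    and M: "M = add_mset (q + size N) (filter_mset ((<) 0) (image_mset (\<lambda>y. y - 1) N) + R)"
    using assms(3) unfolding size_step_def by blast
  have finP: "finite P" using finite_elements[OF fin p] .
  obtain X A where A: "mset_set P = add_mset X A" "card X = q" "image_mset card A = N + R"
    using s(1) msed_map_invR unfolding group_sizes_def by metis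
  obtain F' G' where F': "A = F' + G'" "N = image_mset card F'" "R = image_mset card G'"
    using image_mset_eq_plusD[OF A(3)] by blast
  obtain H F0 where H: "{#X#} = mset_set H" "A = mset_set F0" "H \<union> F0 = P" "H \<inter> F0 = {}"
      "finite H" "finite F0"
    using mset_set_eq_plusD[OF finP, of "{#X#}" A] A(1) by auto
  have HX: "H = {X}" using H(1,5) by (metis finite_set_mset_mset_set set_mset_single)
  obtain F G where F: "F' = mset_set F" "G' = mset_set G" "F \<union> G = F0" "F \<inter> G = {}"
      "finite F" "finite G"
    using mset_set_eq_plusD[OF H(6), of F' G'] F'(1) H(2) by auto
  have P: "P = insert X (F \<union> G)" "X \<notin> F" "X \<notin> G" using H HX F by auto
  have mem: "X \<in> P" "Y \<in> F \<Longrightarrow> Y \<in> P" "Y \<in> G \<Longrightarrow> Y \<in> P" for Y using P(1) by auto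
  have N: "N = image_mset card (mset_set F)" and R: "R = image_mset card (mset_set G)"
    using F' F by auto
  have sN: "size N = card F" using N by simp
  have ne: "Y \<noteq> {}" "finite Y" "Y \<subseteq> V" if "Y \<in> P" for Y
    using that partition_onD3[OF p] partition_onD1[OF p] fin by (auto intro: finite_subset)
  have dis: "Y = Z" if "Y \<in> P" "Z \<in> P" "x \<in> Y" "x \<in> Z" for x Y Z
    using that partition_onD2[OF p] by (auto simp: disjoint_def)
  define f where "f Y = (SOME x. x \<in> Y)" for Y :: "'a set"
  have f: "f Y \<in> Y" if "Y \<in> P" for Y
    using ne(1)[OF that] unfolding f_def by (simp add: some_in_eq)
  define S where "S = f ` F"
  have injf: "inj_on f F" using f dis P by (metis (lifting) Un_iff inj_onI insert_iff)
  have cS: "card S = card F" "finite S" unfolding S_def using injf F by (auto simp: card_image)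
  have FS: "Y - S = Y - {f Y}" if "Y \<in> F" for Y
  proof -
    have "f Z \<notin> Y" if "Z \<in> F" "Z \<noteq> Y" for Z
      using that \<open>Y \<in> F\<close> f[of Z] dis[of Z Y "f Z"] mem by blast
    then show ?thesis using \<open>Y \<in> F\<close> unfolding S_def by blast
  qed
  have GS: "Y \<inter> S = {}" if "Y \<in> G \<or> Y = X" for Y
  proof -
    have "f Z \<notin> Y" if "Z \<in> F" for Z
      using that \<open>Y \<in> G \<or> Y = X\<close> f[of Z] dis[of Z Y "f Z"] mem P(2) F(4) by blast
    then show ?thesis unfolding S_def by blast
  qed
  define Q where "Q = move P S X"
  have SV: "S \<subseteq> V" unfolding S_def using f ne(3) mem(2) by blast
  have q: "partition_on V Q" unfolding Q_def using SV mem(1) by (intro partition_on_move[OF p]) auto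
  have S0: "S \<noteq> {}" using s(2) sN cS by auto
  have cXS: "card (X \<union> S) = q + size N"
    using cS A(2) sN GS[of X] ne(2)[OF mem(1)] by (subst card_Un_disjoint) auto
  have XSQ: "X \<union> S \<in> Q" using S0 by (auto simp: Q_def move_def)
  have "utility (\<lambda>_ _. 1) P u < utility (\<lambda>_ _. 1) Q u" if u: "u \<in> S" for u
  proof -
    obtain Y where Y: "Y \<in> F" "u = f Y" using u S_def by auto
    then have YP: "Y \<in> P" using mem by auto
    have "card Y \<in># N" using Y F(5) N by simp
    then have "card Y < card (X \<union> S)" using s(4) cXS by auto
    then show ?thesis
      using utility_one[OF fin p YP, of u] utility_one[OF fin q XSQ, of u] f[OF YP] Y u by simp
  qed
  then have "is_deviation V (\<lambda>_ _. 1) k P S X"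
    unfolding is_deviation_def using SV S0 cS sN s(3) mem(1) by (auto simp: Q_def)
  then have d: "deviation_step V (\<lambda>_ _. 1) k P Q" unfolding deviation_step_def Q_def by auto
  \<comment> \<open>\<open>F1\<close> collects the groups that survive the loss of one
    player.\<close>
  define F1 where "F1 = {Y \<in> F. 0 < card Y - 1}"
  let ?g = "\<lambda>Y. Y - {f Y}"
  have g: "card (?g Y) = card Y - 1" if "Y \<in> F" for Y
    using f[OF mem(2)[OF that]] by simp
  have g0: "?g Y \<noteq> {} \<longleftrightarrow> 0 < card Y - 1" if "Y \<in> F" for Y
    using g[OF that] ne(2)[OF mem(2)[OF that]] by (metis card_gt_0_iff finite_Diff)
  have F1g: "?g ` F - {{}} = ?g ` F1" unfolding F1_def using g0 by blast
  have Gne: "{} \<notin> G" using ne(1) mem(3) by blast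
  have PX: "P - {X} = F \<union> G" using P by auto
  have "(\<lambda>Y. Y - S) ` F = ?g ` F" using FS by (intro image_cong) auto
  moreover have "(\<lambda>Y. Y - S) ` G = G"
    using GS by (subst image_cong[OF refl, of _ _ "\<lambda>Y. Y"]) auto
  ultimately have "Q = insert (X \<union> S) (?g ` F \<union> G) - {{}}"
    unfolding Q_def move_def PX image_Un by (simp only:)
  also have "\<dots> = insert (X \<union> S) ((?g ` F - {{}}) \<union> G)"
    using S0 Gne by blast
  finally have Q_eq: "Q = insert (X \<union> S) (?g ` F1 \<union> G)"
    unfolding F1g .
  have XS_notin: "X \<union> S \<notin> ?g ` F1 \<union> G"
  proof -
    have "S \<inter> Y = {}" if "Y \<in> ?g ` F1 \<union> G" for Y
      using that GS FS unfolding F1_def by blast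
    then show ?thesis using S0 by blast
  qed
  \<comment> \<open>A nonempty remainder \<open>?g Y\<close> that is also an old group must, by
    disjointness, be \<open>Y\<close> itself, although it lacks \<open>f Y\<close>.\<close>
  have F1G: "?g ` F1 \<inter> G = {}"
  proof -
    have False if "Y \<in> F1" "?g Y \<in> G" for Y
    proof -
      have Y: "Y \<in> F" "?g Y \<noteq> {}" using that g0 unfolding F1_def by auto
      then obtain x where "x \<in> ?g Y" by auto
      then have "?g Y = Y" using dis[of "?g Y" Y x] that(2) Y(1) mem by blast
      then show False using f[of Y] Y(1) mem by blast
    qed
    then show ?thesis by auto
  qed
  have F1fin: "finite F1" using F F1_def by auto
  have inj: "inj_on ?g F1"
  proof (rule inj_onI)
    fix Y Z assume a: "Y \<in> F1" "Z \<in> F1" "?g Y = ?g Z"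
    then obtain x where "x \<in> ?g Y" using g0 unfolding F1_def by blast
    then show "Y = Z" using a dis[of Y Z x] mem unfolding F1_def by blast
  qed
  have "mset_set Q = add_mset (X \<union> S) (mset_set (?g ` F1 \<union> G))"
    unfolding Q_eq using XS_notin F1fin F(6) by (intro mset_set.insert) auto
  also have "mset_set (?g ` F1 \<union> G) = mset_set (?g ` F1) + mset_set G"
    using F1fin F(6) F1G by (intro mset_set_Union) auto
  finally have "group_sizes Q = add_mset (card (X \<union> S))
      (image_mset card (mset_set (?g ` F1)) + image_mset card (mset_set G))"
    unfolding group_sizes_def by (simp only: image_mset_add_mset image_mset_union)
  also have "mset_set (?g ` F1) = image_mset ?g (mset_set F1)"
    using inj by (simp add: image_mset_mset_set)
  also have "image_mset card (image_mset ?g (mset_set F1)) = image_mset (\<lambda>Y. card Y - 1) (mset_set F1)"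
    unfolding multiset.map_comp
    using g F1fin by (intro image_mset_cong) (auto simp: F1_def)
  also have "\<dots> = filter_mset ((<) 0) (image_mset (\<lambda>y. y - 1) N)"
    unfolding N F1_def
    using F(5) by (simp add: filter_mset_image_mset multiset.map_comp comp_def filter_mset_mset_set)
  finally have "group_sizes Q = M" using M R cXS by simp
  then show ?thesis using d q by blast
qed

lemma size_steps_realized:
  assumes "finite V" "(size_step k ^^ m) (group_sizes P) M" "partition_on V P"
  shows "\<exists>Q. (deviation_step V (\<lambda>_ _. 1) k ^^ m) P Q \<and> partition_on V Q \<and> group_sizes Q = M"
  using assms(2,3)
proof (induction m arbitrary: M)
  case 0
  then show ?case by auto
next
  case (Suc m)
  then obtain M1 where M1: "(size_step k ^^ m) (group_sizes P) M1" "size_step k M1 M" by auto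
  from Suc.IH[OF M1(1) Suc.prems(2)] obtain Q where
    "(deviation_step V (\<lambda>_ _. 1) k ^^ m) P Q" "partition_on V Q" "group_sizes Q = M1" by blast
  with M1(2) size_step_realized[OF assms(1), of Q k M] show ?case by auto
qed

lemma steps_le_L:
  assumes "(size_step k ^^ m) (replicate_mset s 1) M" "s \<le> n"
  shows "m \<le> L k n"
proof -
  let ?V = "{..<s}"
  have "group_sizes (singletons ?V) = replicate_mset s 1"
  proof -
    have "mset_set (singletons ?V) = image_mset (\<lambda>u. {u}) (mset_set ?V)"
      unfolding singletons_def by (subst image_mset_mset_set) auto
    then show ?thesis
      unfolding group_sizes_def by (simp add: multiset.map_comp comp_def image_mset_const_eq)
  qed
  then obtain Q where "(deviation_step ?V (\<lambda>_ _. 1) k ^^ m) (singletons ?V) Q"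
    using size_steps_realized[of ?V m k "singletons ?V" M] assms(1)
    by (auto simp: singletons_def partition_on_singletons)
  then have "m \<in> deviation_lengths k n"
    unfolding deviation_lengths_def using uniform_coloring_game_one[of ?V] assms(2) by fastforce
  then show ?thesis unfolding L_def using finite_deviation_lengths by simp
qed

section \<open>Building a stock of groups from singletons\<close>

text \<open>Singletons join the growing group one at a time; each gains because it leaves a group of
  size 1.\<close>

lemma size_steps_build_group:
  assumes "0 < k" "0 < i"
  shows "\<exists>m. (size_step k ^^ m) (replicate_mset i 1 + R) (add_mset i R)"
  using assms(2)
proof (induction i arbitrary: R rule: nat_induct_non_zero)
  case 1
  show ?case by (auto intro!: exI[of _ 0])
next
  case (Suc i)
  obtain m where m: "(size_step k ^^ m) (replicate_mset i 1 + add_mset 1 R) (add_mset i (add_mset 1 R))"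
    using Suc.IH by blast
  have "size_step k (add_mset i (add_mset 1 R)) (add_mset (Suc i) R)"
    using assms(1) Suc.hyps by (intro size_stepI[of _ i "{#1#}" R]) auto
  with m have "(size_step k ^^ Suc m) (replicate_mset (Suc i) 1 + R) (add_mset (Suc i) R)"
    by auto
  then show ?case by blast
qed

lemma size_steps_build:
  assumes "0 < k" "0 \<notin># N"
  shows "\<exists>m. (size_step k ^^ m) (replicate_mset (sum_mset N) 1 + R) (N + R)"
  using assms(2)
proof (induction N arbitrary: R)
  case empty
  show ?case by (auto intro!: exI[of _ 0])
next
  case (add i N)
  obtain m where m: "(size_step k ^^ m) (replicate_mset (sum_mset N) 1 + (replicate_mset i 1 + R))
      (N + (replicate_mset i 1 + R))"
    using add by fastforce
  obtain m' where "(size_step k ^^ m') (replicate_mset i 1 + (N + R)) (add_mset i (N + R))"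
    using size_steps_build_group[OF assms(1), of i "N + R"] add.prems by auto
  then have m': "(size_step k ^^ m') (N + (replicate_mset i 1 + R)) (add_mset i N + R)"
    by (simp add: ac_simps)
  have "replicate_mset (sum_mset (add_mset i N)) 1 + R
      = replicate_mset (sum_mset N) 1 + (replicate_mset i 1 + R)"
    by (rule multiset_eqI) auto
  then show ?case using relpowp_trans[OF m m'] by metis
qed

section \<open>Transfers of exponential length\<close>

text \<open>The stock needed for the long transfer at \<open>p\<close>. The recursive calls change the counts of
  \<open>p - 3\<close>, \<open>p - 2\<close>, \<open>p - 1\<close>, \<open>p\<close> by \<open>1, 0, -3, 2\<close> in total; the thresholds \<open>2, 3, 5\<close> keep each call
  supplied.\<close>

definition stocked :: "nat \<Rightarrow> nat multiset \<Rightarrow> bool" where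
  "stocked p M \<longleftrightarrow> 2 \<le> count M p \<and> 3 \<le> count M (p - 1) \<and> (\<forall>i. 1 \<le> i \<and> i \<le> p - 2 \<longrightarrow> 5 \<le> count M i)"

definition transfer :: "nat \<Rightarrow> nat multiset \<Rightarrow> nat multiset" where
  "transfer p M = (M - {#p, p#}) + {#p - 1, p + 1#}"

text \<open>The mover passes from size \<open>p\<close> to size \<open>p + 1\<close>; by
  \<open>2 \<le> p\<close> the group it leaves survives the filter.\<close>

lemma size_step_transfer:
  assumes "2 \<le> p" "2 \<le> count M p" "0 < k"
  shows "size_step k M (transfer p M)"
proof (rule size_stepI[of M p "{#p#}" "M - {#p, p#}"])
  show "M = add_mset p ({#p#} + (M - {#p, p#}))"
    by (rule multiset_eqI) (use assms in auto)
qed (use assms in \<open>auto simp: transfer_def\<close>)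

text \<open>The target grows from \<open>p - 3\<close> to \<open>p + 1\<close>, so each of the four
  movers, coming from size \<open>p\<close>, gains one.\<close>

lemma size_step_four:
  assumes "4 \<le> p" "1 \<le> count M (p - 3)" "4 \<le> count M p" "4 \<le> k"
  shows "size_step k M ((M - ({#p - 3#} + replicate_mset 4 p)) + (replicate_mset 4 (p - 1) + {#p + 1#}))"
proof (rule size_stepI[of M "p - 3" "replicate_mset 4 p" "M - ({#p - 3#} + replicate_mset 4 p)"])
  show "M = add_mset (p - 3) (replicate_mset 4 p + (M - ({#p - 3#} + replicate_mset 4 p)))"
    by (rule multiset_eqI) (use assms in auto)
qed (use assms in \<open>auto simp: numeral_eq_Suc\<close>)

text \<open>The two recursive calls at \<open>p - 1\<close> double the bound; with the call at
  \<open>p - 2\<close> and the four-player step the total change is that of one transfer.\<close>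

lemma long_transfer:
  assumes "4 \<le> k"
  shows "2 \<le> p \<Longrightarrow> stocked p M \<Longrightarrow> \<exists>m \<ge> 2 ^ (p - 3). (size_step k ^^ m) M (transfer p M)"
proof (induction p arbitrary: M rule: less_induct)
  case (less p)
  show ?case
  proof (cases "p < 4")
    case True
    \<comment> \<open>Truncated subtraction makes the bound \<open>2 ^ 0\<close>, met by one direct
      transfer.\<close>
    then have "p - 3 = 0" by simp
    then show ?thesis
      using size_step_transfer[of p M k] less.prems assms
      by (intro exI[of _ 1]) (auto simp: stocked_def)
  next
    case False
    \<comment> \<open>The successor form of \<open>p\<close> rids all indices of truncated
      subtraction.\<close>
    define q where "q = p - 4"
    have q: "p = Suc (Suc (Suc (Suc q)))" using False by (simp add: q_def)
    define M1 where "M1 = transfer (p - 2) M"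
    define M2 where "M2 = transfer (p - 1) M1"
    define M3 where "M3 = transfer (p - 1) M2"
    note ts = transfer_def M1_def M2_def M3_def
    have c: "2 \<le> count M (Suc (Suc (Suc (Suc q))))" "3 \<le> count M (Suc (Suc (Suc q)))"
        "5 \<le> count M (Suc (Suc q))" "5 \<le> count M (Suc q)"
        "\<And>i. Suc 0 \<le> i \<Longrightarrow> i \<le> Suc (Suc q) \<Longrightarrow> 5 \<le> count M i"
      using less.prems(2) unfolding stocked_def q by (simp_all add: numeral_eq_Suc)
    have s0: "stocked (p - 2) M"
      unfolding stocked_def using c(3,4) by (auto simp: q intro!: c(5))
    \<comment> \<open>Sizes \<open>p - 2\<close> and \<open>p - 1\<close> occur at least 3 and 4
      times in \<open>M1\<close>, and at least 4 and 2 times in \<open>M2\<close>; the next call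
      asks for 3 and 2.\<close>
    have s1: "stocked (p - 1) M1"
      using c(1-4) unfolding stocked_def ts
      by (auto simp: q simp flip: count_greater_zero_iff intro: c(5))
    have s2: "stocked (p - 1) M2"
      using c(1-4) unfolding stocked_def ts
      by (auto simp: q simp flip: count_greater_zero_iff intro: c(5))
    have p: "p - 2 < p" "2 \<le> p - 2" "p - 1 < p" "2 \<le> p - 1" using False by auto
    obtain m0 where m0: "(size_step k ^^ m0) M M1"
      using less.IH[OF p(1,2) s0] unfolding M1_def by blast
    obtain m1 where m1: "m1 \<ge> 2 ^ (p - 1 - 3)" "(size_step k ^^ m1) M1 M2"
      using less.IH[OF p(3,4) s1] unfolding M2_def by blast
    obtain m2 where m2: "m2 \<ge> 2 ^ (p - 1 - 3)" "(size_step k ^^ m2) M2 M3"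
      using less.IH[OF p(3,4) s2] unfolding M3_def by blast
    \<comment> \<open>At sizes \<open>p - 3\<close> to \<open>p + 1\<close> the calls change the
      counts by 1, 0, -3, 2, 0 and the last step by -1, 0, 4, -4, 1; the sum is 0, 0, 1, -2,
      1.\<close>
    have eq: "transfer p M =
        (M3 - ({#p - 3#} + replicate_mset 4 p)) + (replicate_mset 4 (p - 1) + {#p + 1#})"
      using c(1-4) by (intro multiset_eqI) (auto simp: ts q)
    have "1 \<le> count M3 (p - 3)" "4 \<le> count M3 p"
      using c(1-4) by (simp_all add: ts q)
    then have "size_step k M3 (transfer p M)"
      unfolding eq using False assms by (intro size_step_four) auto
    then have "(size_step k ^^ Suc (m0 + m1 + m2)) M (transfer p M)"
      using relpowp_trans[OF relpowp_trans[OF m0 m1(2)] m2(2)] by auto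
    moreover have "(2::nat) ^ (p - 3) = 2 * 2 ^ (p - 1 - 3)"
      using False by (simp flip: power_Suc add: Suc_diff_Suc eval_nat_numeral)
    ultimately show ?thesis using m1(1) m2(1) by (intro exI[of _ "Suc (m0 + m1 + m2)"]) auto
  qed
qed

section \<open>Lower bounds for \<open>L 4 n\<close>\<close>

lemma L_lower_bound:
  assumes "2 \<le> p" "5 * p\<^sup>2 \<le> n"
  shows "2 ^ (p - 3) \<le> L 4 n"
proof -
  \<comment> \<open>Five copies of each size meet every threshold in
    \<open>stocked p\<close>.\<close>
  define N where "N = repeat_mset 5 (mset_set {1..p})"
  have "sum_mset N = 5 * \<Sum>{1..p}"
    by (simp add: N_def eval_nat_numeral sum_unfold_sum_mset)
  also have "\<Sum>{1..p} \<le> p * p"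
    using sum_bounded_above[of "{1..p}" "\<lambda>i. i" p] by auto
  finally have n: "sum_mset N \<le> n" using assms(2) by (simp add: power2_eq_square)
  have "0 \<notin># N" by (simp add: N_def eval_nat_numeral)
  then obtain m where m: "(size_step 4 ^^ m) (replicate_mset (sum_mset N) 1) N"
    using size_steps_build[of 4 N "{#}"] by auto
  have "stocked p N"
    using assms(1) by (auto simp: stocked_def N_def)
  then obtain m' where "m' \<ge> 2 ^ (p - 3)" "(size_step 4 ^^ m') N (transfer p N)"
    using long_transfer[of 4 p N] assms(1) by auto
  then show ?thesis
    using steps_le_L[OF relpowp_trans[OF m] n] by fastforce
qed

text \<open>Take the largest \<open>p\<close> with \<open>5 * p\<^sup>2 \<le> n\<close>; an
  exponential in \<open>sqrt n\<close> eventually exceeds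
  \<open>exp ((ln n)\<^sup>2)\<close>.\<close>

lemma L_superpolynomial:
  "\<forall>\<^sub>F n in sequentially. real n powr ln (real n) \<le> real (L 4 n)"
proof -
  have "\<forall>\<^sub>F n in sequentially. 2 \<le> sqrt (real n / 5)"
    by real_asymp
  \<comment> \<open>Of the 4, 3 stems from the exponent \<open>p - 3\<close> and 1 from rounding
    down to \<open>p\<close>.\<close>
  moreover have "\<forall>\<^sub>F n in sequentially. real n powr ln (real n) \<le> 2 powr (sqrt (real n / 5) - 4)"
    by real_asymp
  ultimately show ?thesis
  proof eventually_elim
    case (elim n)
    define p where "p = nat \<lfloor>sqrt (real n / 5)\<rfloor>"
    have p: "real p \<le> sqrt (real n / 5)" "sqrt (real n / 5) < real p + 1" "2 \<le> p"
      using elim(1) by (auto simp: p_def le_nat_iff le_floor_iff)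
    have "(real p)\<^sup>2 \<le> real n / 5" using p(1) by (metis abs_of_nat real_sqrt_abs real_sqrt_le_iff)
    then have "real (5 * p\<^sup>2) \<le> real n" by simp
    then have "2 ^ (p - 3) \<le> L 4 n" using L_lower_bound[OF p(3)] of_nat_le_iff by blast
    then have "2 ^ (p - 3) \<le> real (L 4 n)" by (metis of_nat_le_iff of_nat_numeral of_nat_power)
    moreover have "2 powr (sqrt (real n / 5) - 4) \<le> 2 powr real (p - 3)"
      using p(2) by (intro powr_mono) auto
    moreover have "2 powr real (p - 3) = 2 ^ (p - 3)"
      by (simp add: powr_realpow)
    ultimately show ?case using elim(2) by linarith
  qed
qed

section \<open>Comparison with polynomials\<close>

text \<open>Induction along the Horner scheme: for \<open>1 \<le> x\<close> the new constant is
  absorbed into \<open>x ^ Suc d\<close>.\<close>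

lemma abs_poly_le_monom:
  fixes p :: "real poly"
  shows "\<exists>C d. \<forall>x\<ge>1. \<bar>poly p x\<bar> \<le> C * x ^ d"
proof (induction p)
  case 0
  show ?case by (auto intro!: exI[of _ 0])
next
  case (pCons a p)
  then obtain C d where C: "\<bar>poly p x\<bar> \<le> C * x ^ d" if "1 \<le> x" for x by blast
  have "\<bar>poly (pCons a p) x\<bar> \<le> (\<bar>a\<bar> + C) * x ^ Suc d" if "1 \<le> x" for x
  proof -
    have "\<bar>poly (pCons a p) x\<bar> \<le> \<bar>a\<bar> * 1 + x * \<bar>poly p x\<bar>"
      using abs_triangle_ineq[of a "x * poly p x"] that by (simp add: abs_mult)
    also have "\<dots> \<le> \<bar>a\<bar> * x ^ Suc d + x * (C * x ^ d)"
      using that C[OF that] one_le_power[OF that, of "Suc d"]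
      by (intro add_mono mult_left_mono) auto
    finally show ?thesis by (simp add: algebra_simps)
  qed
  then show ?case by blast
qed

text \<open>Once \<open>C < x\<close> and \<open>Suc d \<le> ln x\<close>, the bound
  \<open>C * x ^ d\<close> lies below \<open>x ^ Suc d\<close>, which is at most
  \<open>x powr ln x\<close>.\<close>

lemma poly_less_powr_ln:
  fixes p :: "real poly"
  shows "\<forall>\<^sub>F x in at_top. poly p x < x powr ln x"
proof -
  obtain C d where C: "\<And>x. 1 \<le> x \<Longrightarrow> \<bar>poly p x\<bar> \<le> C * x ^ d"
    using abs_poly_le_monom by blast
  have "\<forall>\<^sub>F x in at_top. real (Suc d) \<le> ln x"
    using ln_at_top by (simp add: filterlim_at_top)
  then show ?thesis
    using eventually_gt_at_top[of C] eventually_ge_at_top[of 1]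
  proof eventually_elim
    case (elim x)
    have "poly p x \<le> C * x ^ d" using C[OF elim(3)] by simp
    also have "\<dots> < x * x ^ d" using elim by (intro mult_strict_right_mono) auto
    also have "\<dots> = x powr real (Suc d)" using elim(3) by (subst powr_realpow) auto
    also have "\<dots> \<le> x powr ln x" using elim by (intro powr_mono) auto
    finally show ?case .
  qed
qed

theorem theorem4:
  shows "(\<exists>g :: nat \<Rightarrow> real. (\<forall>n. 0 \<le> g n) \<and> g \<in> \<Theta>(\<lambda>n. ln (real n)) \<and>
            (\<lambda>n. real (L 4 n)) \<in> \<Omega>(\<lambda>n. real n powr g n)) \<and>
         (\<forall>p :: real poly. \<not> (\<forall>\<^sub>F n in sequentially. real (L 4 n) \<le> poly p (real n)))"
proof (intro conjI allI notI)
  \<comment> \<open>The witness for \<open>g\<close> is \<open>ln\<close> itself; the case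
    \<open>n = 0\<close> rests on the default value \<open>ln 0 = 0\<close>.\<close>
  have "0 \<le> ln (real n)" for n by (cases n) auto
  moreover have "(\<lambda>n. real (L 4 n)) \<in> \<Omega>(\<lambda>n. real n powr ln (real n))"
    using L_superpolynomial by (intro landau_omega.bigI[of 1]) auto
  ultimately show "\<exists>g :: nat \<Rightarrow> real. (\<forall>n. 0 \<le> g n) \<and> g \<in> \<Theta>(\<lambda>n. ln (real n)) \<and>
      (\<lambda>n. real (L 4 n)) \<in> \<Omega>(\<lambda>n. real n powr g n)"
    by (intro exI[of _ "\<lambda>n. ln (real n)"]) simp
next
  fix p :: "real poly"
  assume "\<forall>\<^sub>F n in sequentially. real (L 4 n) \<le> poly p (real n)"
  moreover have "\<forall>\<^sub>F n in sequentially. poly p (real n) < real n powr ln (real n)"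
    using poly_less_powr_ln filterlim_real_sequentially by (rule eventually_compose_filterlim)
  ultimately have "\<forall>\<^sub>F n :: nat in sequentially. False"
    using L_superpolynomial by eventually_elim simp
  then show False by simp
qed

end
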